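(* Let $(\mathcal A,\mathcal E)$ be an exact category. Let $\phi:\mathcal A\to\mathbb Z_{\le 0}$ be a function on the objects of $\mathcal A$ such that $\phi$ is constant on isomorphism classes of objects in $\mathcal A$, $\phi$ is additive on finite biproducts, and $\phi$ is sub-additive on kernel-cokernel pairs in $\mathcal E$ (i.e., if $M\rightarrowtail N\twoheadrightarrow L$ is in $\mathcal E$, then $\phi(N)\le\phi(M)+\phi(L)$). Let $\mathcal A'$ be the strictly full subcategory of $\mathcal A$ whose objects are given by $\{M\in\mathcal A:\phi(M)=0\}$. Then $(\mathcal A',\mathcal E|_{\mathcal A'})$ is an exact subcategory of $(\mathcal A,\mathcal E)$.
   Context: An exact category $(\mathcal A,\mathcal E)$ (Quillen) is an additive category $\mathcal A$ with a class $\mathcal E$ of kernel-cokernel pairs $M\xrightarrow{i}N\xrightarrow{p}L$ ($i$ is a kernel of $p$ and $p$ is a cokernel of $i$), closed under isomorphism, such that, calling the maps $i$ (resp. $p$) occurring in $\mathcal E$ admissible monics (resp. epics): identities are admissible monics and admissible epics; admissible monics (resp. epics) are closed under composition; the pushout of an admissible monic along any morphism exists and is an admissible monic; the pullback of an admissible epic along any morphism exists and is an admissible epic. Strictly full means full and closed under isomorphism. For a strictly full subcategory $\mathcal A'$, $\mathcal E|_{\mathcal A'}$ is the class of those $M\rightarrowtail N\twoheadrightarrow L$ in $\mathcal E$ with $M,N,L\in\mathcal A'$. An exact subcategory of $(\mathcal A,\mathcal E)$ is an exact category $(\mathcal A',\mathcal E')$ where $\mathcal A'$ is a strictly full additive subcategory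 of $\mathcal A$ and $\mathcal E'\subseteq\mathcal E$. *)

theory Defs
  imports "HOL-Algebra.FiniteProduct"
begin

section \<open>Additive categories\<close>

(* A one-sorted presentation of the arrows: Hom-sets are automatically disjoint.
   Only the values of the operations on objects and on (composable or parallel) arrows
   of the category are meaningful. "g \<cdot> f" is composition in the order "first f, then g". *)
record ('o, 'm) cat =
  Obj :: "'o set"
  Arr :: "'m set"
  Dom :: "'m \<Rightarrow> 'o"
  Cod :: "'m \<Rightarrow> 'o"
  Ident :: "'o \<Rightarrow> 'm"
  Comp :: "'m \<Rightarrow> 'm \<Rightarrow> 'm"  (infixl \<open>\<cdot>\<index>\<close> 70)
  Add :: "'m \<Rightarrow> 'm \<Rightarrow> 'm"
  Zero :: "'o \<Rightarrow> 'o \<Rightarrow> 'm"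

definition Hom :: "('o, 'm) cat \<Rightarrow> 'o \<Rightarrow> 'o \<Rightarrow> 'm set" where
  "Hom C X Y = {f \<in> Arr C. Dom C f = X \<and> Cod C f = Y}"

(* The additive group of arrows from X to Y, written as a HOL-Algebra (multiplicative) monoid
   so that comm_group and finprod can be used. *)
definition Hom_group :: "('o, 'm) cat \<Rightarrow> 'o \<Rightarrow> 'o \<Rightarrow> 'm monoid" where
  "Hom_group C X Y = \<lparr>carrier = Hom C X Y, mult = Add C, one = Zero C X Y\<rparr>"

locale category =
  fixes C :: "('o, 'm) cat" (structure)
  assumes Dom_in_Obj: "f \<in> Arr C \<Longrightarrow> Dom C f \<in> Obj C"
    and Cod_in_Obj: "f \<in> Arr C \<Longrightarrow> Cod C f \<in> Obj C"
    and Ident_in_Hom: "X \<in> Obj C \<Longrightarrow> Ident C X \<in> Hom C X X"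
    and Comp_in_Hom: "f \<in> Hom C X Y \<Longrightarrow> g \<in> Hom C Y Z \<Longrightarrow> g \<cdot> f \<in> Hom C X Z"
    and Comp_Ident: "f \<in> Hom C X Y \<Longrightarrow> f \<cdot> Ident C X = f"
    and Ident_Comp: "f \<in> Hom C X Y \<Longrightarrow> Ident C Y \<cdot> f = f"
    and Comp_assoc: "f \<in> Hom C W X \<Longrightarrow> g \<in> Hom C X Y \<Longrightarrow> h \<in> Hom C Y Z
          \<Longrightarrow> (h \<cdot> g) \<cdot> f = h \<cdot> (g \<cdot> f)"

locale preadditive_category = category +
  assumes Hom_comm_group: "X \<in> Obj C \<Longrightarrow> Y \<in> Obj C \<Longrightarrow> comm_group (Hom_group C X Y)"
    and Comp_Add_left: "f \<in> Hom C X Y \<Longrightarrow> g \<in> Hom C Y Z \<Longrightarrow> g' \<in> Hom C Y Z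
          \<Longrightarrow> Add C g g' \<cdot> f = Add C (g \<cdot> f) (g' \<cdot> f)"
    and Comp_Add_right: "f \<in> Hom C X Y \<Longrightarrow> f' \<in> Hom C X Y \<Longrightarrow> g \<in> Hom C Y Z
          \<Longrightarrow> g \<cdot> Add C f f' = Add C (g \<cdot> f) (g \<cdot> f')"

(* B with injections \<iota> and projections \<pi> is a biproduct of the finite family X 0, ..., X (n - 1).
   The finprod is the sum of the \<iota> k \<cdot> \<pi> k in the additive group Hom B B. For n = 0 the condition
   says that the identity of B is zero, i.e. that B is a zero object. *)
definition is_biproduct ::
  "('o, 'm) cat \<Rightarrow> nat \<Rightarrow> (nat \<Rightarrow> 'o) \<Rightarrow> 'o \<Rightarrow> (nat \<Rightarrow> 'm) \<Rightarrow> (nat \<Rightarrow> 'm) \<Rightarrow> bool" where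
  "is_biproduct C n X B \<iota> \<pi> \<longleftrightarrow>
     B \<in> Obj C \<and>
     (\<forall>k<n. X k \<in> Obj C \<and> \<iota> k \<in> Hom C (X k) B \<and> \<pi> k \<in> Hom C B (X k)) \<and>
     (\<forall>j<n. \<forall>k<n. \<pi> j \<cdot>\<^bsub>C\<^esub> \<iota> k = (if j = k then Ident C (X k) else Zero C (X k) (X j))) \<and>
     finprod (Hom_group C B B) (\<lambda>k. \<iota> k \<cdot>\<^bsub>C\<^esub> \<pi> k) {..<n} = Ident C B"

locale additive_category = preadditive_category +
  assumes biproducts_exist:
    "(\<And>k. k < n \<Longrightarrow> X k \<in> Obj C) \<Longrightarrow> \<exists>B \<iota> \<pi>. is_biproduct C n X B \<iota> \<pi>"

definition is_iso :: "('o, 'm) cat \<Rightarrow> 'm \<Rightarrow> 'o \<Rightarrow> 'o \<Rightarrow> bool" where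
  "is_iso C f X Y \<longleftrightarrow> f \<in> Hom C X Y \<and>
     (\<exists>g \<in> Hom C Y X. g \<cdot>\<^bsub>C\<^esub> f = Ident C X \<and> f \<cdot>\<^bsub>C\<^esub> g = Ident C Y)"

definition isomorphic :: "('o, 'm) cat \<Rightarrow> 'o \<Rightarrow> 'o \<Rightarrow> bool" where
  "isomorphic C X Y \<longleftrightarrow> X \<in> Obj C \<and> Y \<in> Obj C \<and> (\<exists>f. is_iso C f X Y)"

definition is_kernel :: "('o, 'm) cat \<Rightarrow> 'm \<Rightarrow> 'm \<Rightarrow> bool" where
  "is_kernel C i p \<longleftrightarrow>
     i \<in> Arr C \<and> p \<in> Arr C \<and> Cod C i = Dom C p \<and>
     p \<cdot>\<^bsub>C\<^esub> i = Zero C (Dom C i) (Cod C p) \<and>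
     (\<forall>X \<in> Obj C. \<forall>f \<in> Hom C X (Dom C p). p \<cdot>\<^bsub>C\<^esub> f = Zero C X (Cod C p) \<longrightarrow>
        (\<exists>!u. u \<in> Hom C X (Dom C i) \<and> i \<cdot>\<^bsub>C\<^esub> u = f))"

definition is_cokernel :: "('o, 'm) cat \<Rightarrow> 'm \<Rightarrow> 'm \<Rightarrow> bool" where
  "is_cokernel C p i \<longleftrightarrow>
     i \<in> Arr C \<and> p \<in> Arr C \<and> Cod C i = Dom C p \<and>
     p \<cdot>\<^bsub>C\<^esub> i = Zero C (Dom C i) (Cod C p) \<and>
     (\<forall>X \<in> Obj C. \<forall>f \<in> Hom C (Cod C i) X. f \<cdot>\<^bsub>C\<^esub> i = Zero C (Dom C i) X \<longrightarrow>
        (\<exists>!u. u \<in> Hom C (Cod C p) X \<and> u \<cdot>\<^bsub>C\<^esub> p = f))"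

definition kernel_cokernel_pair :: "('o, 'm) cat \<Rightarrow> 'm \<Rightarrow> 'm \<Rightarrow> bool" where
  "kernel_cokernel_pair C i p \<longleftrightarrow> is_kernel C i p \<and> is_cokernel C p i"

(* The pushout of the span N <-i- M -f-> M' is given by i' : M' -> P and f' : N -> P. *)
definition is_pushout :: "('o, 'm) cat \<Rightarrow> 'm \<Rightarrow> 'm \<Rightarrow> 'm \<Rightarrow> 'm \<Rightarrow> bool" where
  "is_pushout C i f i' f' \<longleftrightarrow>
     i \<in> Arr C \<and> f \<in> Arr C \<and> i' \<in> Arr C \<and> f' \<in> Arr C \<and>
     Dom C i = Dom C f \<and> Dom C i' = Cod C f \<and> Dom C f' = Cod C i \<and> Cod C i' = Cod C f' \<and>
     i' \<cdot>\<^bsub>C\<^esub> f = f' \<cdot>\<^bsub>C\<^esub> i \<and>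
     (\<forall>X \<in> Obj C. \<forall>a \<in> Hom C (Cod C f) X. \<forall>b \<in> Hom C (Cod C i) X.
        a \<cdot>\<^bsub>C\<^esub> f = b \<cdot>\<^bsub>C\<^esub> i \<longrightarrow>
        (\<exists>!u. u \<in> Hom C (Cod C i') X \<and> u \<cdot>\<^bsub>C\<^esub> i' = a \<and> u \<cdot>\<^bsub>C\<^esub> f' = b))"

(* The pullback of the cospan N -p-> L <-f- L' is given by p' : P -> L' and f' : P -> N. *)
definition is_pullback :: "('o, 'm) cat \<Rightarrow> 'm \<Rightarrow> 'm \<Rightarrow> 'm \<Rightarrow> 'm \<Rightarrow> bool" where
  "is_pullback C p f p' f' \<longleftrightarrow>
     p \<in> Arr C \<and> f \<in> Arr C \<and> p' \<in> Arr C \<and> f' \<in> Arr C \<and>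
     Cod C p = Cod C f \<and> Cod C p' = Dom C f \<and> Cod C f' = Dom C p \<and> Dom C p' = Dom C f' \<and>
     f \<cdot>\<^bsub>C\<^esub> p' = p \<cdot>\<^bsub>C\<^esub> f' \<and>
     (\<forall>X \<in> Obj C. \<forall>a \<in> Hom C X (Dom C f). \<forall>b \<in> Hom C X (Dom C p).
        f \<cdot>\<^bsub>C\<^esub> a = p \<cdot>\<^bsub>C\<^esub> b \<longrightarrow>
        (\<exists>!u. u \<in> Hom C X (Dom C p') \<and> p' \<cdot>\<^bsub>C\<^esub> u = a \<and> f' \<cdot>\<^bsub>C\<^esub> u = b))"


section \<open>Exact categories\<close>

(* A class of sequences M -i-> N -p-> L is a set of pairs (i, p): the three objects are
   Dom i, Cod i = Dom p and Cod p. *)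

definition admissible_monic :: "('m \<times> 'm) set \<Rightarrow> 'm \<Rightarrow> bool" where
  "admissible_monic E i \<longleftrightarrow> (\<exists>p. (i, p) \<in> E)"

definition admissible_epic :: "('m \<times> 'm) set \<Rightarrow> 'm \<Rightarrow> bool" where
  "admissible_epic E p \<longleftrightarrow> (\<exists>i. (i, p) \<in> E)"

locale exact_category = additive_category +
  fixes E :: "('m \<times> 'm) set"
  assumes E_kernel_cokernel: "(i, p) \<in> E \<Longrightarrow> kernel_cokernel_pair C i p"
    and E_iso_closed:
      "(i, p) \<in> E \<Longrightarrow> i' \<in> Hom C M' N' \<Longrightarrow> p' \<in> Hom C N' L'
        \<Longrightarrow> is_iso C a (Dom C i) M' \<Longrightarrow> is_iso C b (Cod C i) N' \<Longrightarrow> is_iso C c (Cod C p) L'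
        \<Longrightarrow> b \<cdot> i = i' \<cdot> a \<Longrightarrow> c \<cdot> p = p' \<cdot> b \<Longrightarrow> (i', p') \<in> E"
    and Ident_admissible_monic: "X \<in> Obj C \<Longrightarrow> admissible_monic E (Ident C X)"
    and Ident_admissible_epic: "X \<in> Obj C \<Longrightarrow> admissible_epic E (Ident C X)"
    and admissible_monic_Comp:
      "admissible_monic E i \<Longrightarrow> admissible_monic E j \<Longrightarrow> Cod C i = Dom C j
        \<Longrightarrow> admissible_monic E (j \<cdot> i)"
    and admissible_epic_Comp:
      "admissible_epic E p \<Longrightarrow> admissible_epic E q \<Longrightarrow> Cod C p = Dom C q
        \<Longrightarrow> admissible_epic E (q \<cdot> p)"
    and pushout_exists:
      "admissible_monic E i \<Longrightarrow> f \<in> Arr C \<Longrightarrow> Dom C f = Dom C i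
        \<Longrightarrow> \<exists>i' f'. is_pushout C i f i' f'"
    and pushout_admissible_monic:
      "admissible_monic E i \<Longrightarrow> is_pushout C i f i' f' \<Longrightarrow> admissible_monic E i'"
    and pullback_exists:
      "admissible_epic E p \<Longrightarrow> f \<in> Arr C \<Longrightarrow> Cod C f = Cod C p
        \<Longrightarrow> \<exists>p' f'. is_pullback C p f p' f'"
    and pullback_admissible_epic:
      "admissible_epic E p \<Longrightarrow> is_pullback C p f p' f' \<Longrightarrow> admissible_epic E p'"


section \<open>Exact subcategories\<close>

(* D is a full subcategory of C closed under isomorphism in C, with the operations inherited
   from C (including the addition of arrows, so that the inclusion is an additive functor). *)
definition strictly_full_subcategory :: "('o, 'm) cat \<Rightarrow> ('o, 'm) cat \<Rightarrow> bool" where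
  "strictly_full_subcategory D C \<longleftrightarrow>
     Obj D \<subseteq> Obj C \<and>
     Arr D = {f \<in> Arr C. Dom C f \<in> Obj D \<and> Cod C f \<in> Obj D} \<and>
     (\<forall>f \<in> Arr D. Dom D f = Dom C f \<and> Cod D f = Cod C f) \<and>
     (\<forall>X \<in> Obj D. Ident D X = Ident C X) \<and>
     (\<forall>f \<in> Arr D. \<forall>g \<in> Arr D. Cod C f = Dom C g \<longrightarrow> g \<cdot>\<^bsub>D\<^esub> f = g \<cdot>\<^bsub>C\<^esub> f) \<and>
     (\<forall>f \<in> Arr D. \<forall>g \<in> Arr D. Dom C f = Dom C g \<and> Cod C f = Cod C g \<longrightarrow>
        Add D f g = Add C f g) \<and>
     (\<forall>X \<in> Obj D. \<forall>Y \<in> Obj D. Zero D X Y = Zero C X Y) \<and>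
     (\<forall>X Y. X \<in> Obj D \<and> isomorphic C X Y \<longrightarrow> Y \<in> Obj D)"

definition exact_subcategory ::
  "('o, 'm) cat \<Rightarrow> ('m \<times> 'm) set \<Rightarrow> ('o, 'm) cat \<Rightarrow> ('m \<times> 'm) set \<Rightarrow> bool" where
  "exact_subcategory D E' C E \<longleftrightarrow>
     exact_category C E \<and> exact_category D E' \<and> strictly_full_subcategory D C \<and> E' \<subseteq> E"

definition full_subcategory_on :: "('o, 'm) cat \<Rightarrow> 'o set \<Rightarrow> ('o, 'm) cat" where
  "full_subcategory_on C S =
     C\<lparr>Obj := S, Arr := {f \<in> Arr C. Dom C f \<in> S \<and> Cod C f \<in> S}\<rparr>"

definition restrict_sequences :: "('o, 'm) cat \<Rightarrow> ('m \<times> 'm) set \<Rightarrow> 'o set \<Rightarrow> ('m \<times> 'm) set" where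
  "restrict_sequences C E S =
     {(i, p) \<in> E. Dom C i \<in> S \<and> Cod C i \<in> S \<and> Cod C p \<in> S}"

end

(* Since phi is nonpositive and subadditive, phi(N) = 0 forces phi(M) = phi(L) = 0 for every
   M >-> N ->> L in E: the zero locus of phi is closed under admissible subobjects and quotients,
   and by additivity under finite biproducts. Any such class S of objects spans an exact
   subcategory. Identities and compositions are immediate. For the pushout P of an admissible monic
   m : M -> N along f : M -> M', the map (m, -f) : M -> N + M' is an admissible monic, namely
   (m + 1) o (1, -f), and its cokernel is P, so P is a quotient of an object of S. Pullbacks are
   dual. *)
theory Submission
  imports Defs
begin

section \<open>Arrow calculus in preadditive categories\<close>

text \<open>The usual criterion for an exact subcategory, closure under extensions, is out of reach:
  if \<phi> vanishes at both ends of a sequence, subadditivity only says \<phi>(N) \<le> 0 in the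
  middle. The pushout must therefore be caught as a quotient of a biproduct, never as an extension.
  Two points need care. Split sequences are not among the axioms, so (1, -f) has to be built by a
  pushout of its own, starting from 0 -> Y, which is found as the kernel of an identity. And a
  pushout formed inside the subcategory is tested against fewer objects, so it is not evidently a
  pushout in the ambient category; it is compared with an ambient pushout that is known to stay
  inside.\<close>

lemma HomI: "f \<in> Arr C \<Longrightarrow> Dom C f = X \<Longrightarrow> Cod C f = Y \<Longrightarrow> f \<in> Hom C X Y"
  by (simp add: Hom_def)

lemma HomD:
  assumes "f \<in> Hom C X Y"
  shows "f \<in> Arr C" "Dom C f = X" "Cod C f = Y"
  using assms by (auto simp: Hom_def)

section \<open>Composition and identities\<close>

context category
begin

lemma arr_Ident [simp]:
  assumes "X \<in> Obj C"
  shows "Ident C X \<in> Arr C" "Dom C (Ident C X) = X" "Cod C (Ident C X) = X"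
  using HomD[OF Ident_in_Hom[OF assms]] by auto

text \<open>Typing is expressed by equations on \<open>Dom\<close> and \<open>Cod\<close> instead of
  membership in \<open>Hom\<close>, whose intermediate object the simplifier would have to
  guess.\<close>

lemma arr_Comp [simp]:
  assumes "f \<in> Arr C" "g \<in> Arr C" "Cod C f = Dom C g"
  shows "g \<cdot> f \<in> Arr C" "Dom C (g \<cdot> f) = Dom C f" "Cod C (g \<cdot> f) = Cod C g"
  using HomD[OF Comp_in_Hom[of f "Dom C f" "Cod C f" g "Cod C g"]] assms by (auto simp: Hom_def)

lemma Comp_Ident_arr [simp]: "f \<in> Arr C \<Longrightarrow> Dom C f = X \<Longrightarrow> f \<cdot> Ident C X = f"
  using Comp_Ident[of f] by (auto simp: Hom_def)

lemma Ident_Comp_arr [simp]: "f \<in> Arr C \<Longrightarrow> Cod C f = Y \<Longrightarrow> Ident C Y \<cdot> f = f"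
  using Ident_Comp[of f] by (auto simp: Hom_def)

lemma Comp_assoc_arr:
  "f \<in> Arr C \<Longrightarrow> g \<in> Arr C \<Longrightarrow> h \<in> Arr C \<Longrightarrow> Cod C f = Dom C g \<Longrightarrow> Cod C g = Dom C h
    \<Longrightarrow> (h \<cdot> g) \<cdot> f = h \<cdot> (g \<cdot> f)"
  using Comp_assoc[of f "Dom C f" "Cod C f" g "Cod C g" h "Cod C h"] by (auto simp: Hom_def)

text \<open>Rewriting with \<open>Comp_assoc_arr\<close> nests composites to the right, where a
  known product \<open>a \<cdot> b\<close> is no longer a subterm; this is its form inside such a
  nest.\<close>

lemma Comp_reduce:
  assumes "a \<cdot> b = c" "a \<in> Arr C" "b \<in> Arr C" "x \<in> Arr C" "Cod C b = Dom C a" "Cod C x = Dom C b"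
  shows "a \<cdot> (b \<cdot> x) = c \<cdot> x"
  using assms Comp_assoc_arr[of x b a] by auto

lemma is_iso_Ident: "X \<in> Obj C \<Longrightarrow> is_iso C (Ident C X) X X"
  unfolding is_iso_def by (auto intro!: HomI bexI[of _ "Ident C X"])

end

section \<open>Addition and zero arrows\<close>

context preadditive_category
begin

lemma arr_Zero [simp]:
  assumes "X \<in> Obj C" "Y \<in> Obj C"
  shows "Zero C X Y \<in> Arr C" "Dom C (Zero C X Y) = X" "Cod C (Zero C X Y) = Y"
proof -
  interpret comm_group "Hom_group C X Y" using assms by (rule Hom_comm_group)
  have "Zero C X Y \<in> Hom C X Y" using one_closed by (simp add: Hom_group_def)
  then show "Zero C X Y \<in> Arr C" "Dom C (Zero C X Y) = X" "Cod C (Zero C X Y) = Y"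
    by (auto simp: Hom_def)
qed

lemma Hom_Obj: "f \<in> Hom C X Y \<Longrightarrow> X \<in> Obj C \<and> Y \<in> Obj C"
  using Dom_in_Obj Cod_in_Obj by (auto simp: Hom_def)

lemma arr_Add [simp]:
  assumes "f \<in> Arr C" "g \<in> Arr C" "Dom C f = Dom C g" "Cod C f = Cod C g"
  shows "Add C f g \<in> Arr C" "Dom C (Add C f g) = Dom C g" "Cod C (Add C f g) = Cod C g"
proof -
  interpret comm_group "Hom_group C (Dom C g) (Cod C g)"
    using assms Dom_in_Obj Cod_in_Obj by (intro Hom_comm_group) auto
  have "Add C f g \<in> Hom C (Dom C g) (Cod C g)"
    using assms m_closed[of f g] by (simp add: Hom_group_def Hom_def)
  then show "Add C f g \<in> Arr C" "Dom C (Add C f g) = Dom C g" "Cod C (Add C f g) = Cod C g"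
    by (auto simp: Hom_def)
qed

lemma Add_assoc:
  assumes "f \<in> Hom C X Y" "g \<in> Hom C X Y" "h \<in> Hom C X Y"
  shows "Add C (Add C f g) h = Add C f (Add C g h)"
proof -
  interpret comm_group "Hom_group C X Y" using assms Hom_Obj by (intro Hom_comm_group) auto
  show ?thesis using m_assoc[of f g h] assms by (simp add: Hom_group_def)
qed

lemma Add_Zero [simp]:
  assumes "f \<in> Arr C" "Dom C f = X" "Cod C f = Y"
  shows "Add C f (Zero C X Y) = f" "Add C (Zero C X Y) f = f"
proof -
  interpret comm_group "Hom_group C X Y"
    using assms Dom_in_Obj Cod_in_Obj by (intro Hom_comm_group) auto
  show "Add C f (Zero C X Y) = f" "Add C (Zero C X Y) f = f"
    using r_one[of f] l_one[of f] assms by (simp_all add: Hom_group_def Hom_def)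
qed

lemma Add_right_cancel:
  assumes "f \<in> Hom C X Y" "g \<in> Hom C X Y" "h \<in> Hom C X Y" "Add C f h = Add C g h"
  shows "f = g"
proof -
  interpret comm_group "Hom_group C X Y" using assms Hom_Obj by (intro Hom_comm_group) auto
  show ?thesis using right_cancel[of h f g] assms by (simp add: Hom_group_def)
qed

text \<open>The record \<open>cat\<close> has no negation, so a negative is a witness taken from the
  Hom group. Recording both orders spares appeals to commutativity.\<close>

lemma negative_exists:
  assumes "f \<in> Hom C X Y"
  obtains g where "g \<in> Hom C X Y" "Add C f g = Zero C X Y" "Add C g f = Zero C X Y"
proof -
  interpret comm_group "Hom_group C X Y" using assms Hom_Obj by (intro Hom_comm_group) auto
  show ?thesis
    using that inv_closed[of f] r_inv[of f] l_inv[of f] assms by (simp add: Hom_group_def)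
qed

lemma Comp_Add_left_arr [simp]:
  assumes "f \<in> Arr C" "g \<in> Arr C" "g' \<in> Arr C" "Cod C f = Dom C g" "Dom C g' = Dom C g"
    "Cod C g' = Cod C g"
  shows "Add C g g' \<cdot> f = Add C (g \<cdot> f) (g' \<cdot> f)"
  using assms Comp_Add_left[of f "Dom C f" "Cod C f" g "Cod C g" g'] by (auto simp: Hom_def)

lemma Comp_Add_right_arr [simp]:
  assumes "f \<in> Arr C" "f' \<in> Arr C" "g \<in> Arr C" "Cod C f = Dom C g" "Dom C f' = Dom C f"
    "Cod C f' = Cod C f"
  shows "g \<cdot> Add C f f' = Add C (g \<cdot> f) (g \<cdot> f')"
  using assms Comp_Add_right[of f "Dom C f" "Cod C f" f' g "Cod C g"] by (auto simp: Hom_def)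

text \<open>Bilinearity forces this: g 0 = g (0 + 0) = g 0 + g 0, and one summand cancels.\<close>

lemma Comp_Zero [simp]:
  assumes "g \<in> Arr C" "Dom C g = Y" "X \<in> Obj C"
  shows "g \<cdot> Zero C X Y = Zero C X (Cod C g)"
proof -
  have Y: "Y \<in> Obj C" and Z: "Cod C g \<in> Obj C" using assms Dom_in_Obj Cod_in_Obj by auto
  have "g \<cdot> Zero C X Y = g \<cdot> Add C (Zero C X Y) (Zero C X Y)" using assms Y by simp
  also have "\<dots> = Add C (g \<cdot> Zero C X Y) (g \<cdot> Zero C X Y)"
    using assms Y by (intro Comp_Add_right_arr) auto
  finally show ?thesis
    using assms Y Z
      Add_right_cancel[of "g \<cdot> Zero C X Y" X "Cod C g" "Zero C X (Cod C g)" "g \<cdot> Zero C X Y"]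
    by (simp add: Hom_def)
qed

lemma Zero_Comp [simp]:
  assumes "f \<in> Arr C" "Cod C f = Y" "Z \<in> Obj C"
  shows "Zero C Y Z \<cdot> f = Zero C (Dom C f) Z"
proof -
  have Y: "Y \<in> Obj C" and X: "Dom C f \<in> Obj C" using assms Dom_in_Obj Cod_in_Obj by auto
  have "Zero C Y Z \<cdot> f = Add C (Zero C Y Z) (Zero C Y Z) \<cdot> f" using assms Y by simp
  also have "\<dots> = Add C (Zero C Y Z \<cdot> f) (Zero C Y Z \<cdot> f)"
    using assms Y by (intro Comp_Add_left_arr) auto
  finally show ?thesis
    using assms Y X
      Add_right_cancel[of "Zero C Y Z \<cdot> f" "Dom C f" Z "Zero C (Dom C f) Z" "Zero C Y Z \<cdot> f"]
    by (simp add: Hom_def)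
qed

end

section \<open>Binary biproducts\<close>

text \<open>The case of two summands, with the \<open>finprod\<close> in the Hom group unfolded into
  a single \<open>Add\<close>. Injections are \<open>i\<close>, \<open>j\<close>; projections are
  \<open>p\<close>, \<open>q\<close>.\<close>

definition is_binary_biproduct ::
  "('o, 'm) cat \<Rightarrow> 'o \<Rightarrow> 'o \<Rightarrow> 'o \<Rightarrow> 'm \<Rightarrow> 'm \<Rightarrow> 'm \<Rightarrow> 'm \<Rightarrow> bool" where
  "is_binary_biproduct C X Y B i j p q \<longleftrightarrow>
     i \<in> Hom C X B \<and> j \<in> Hom C Y B \<and> p \<in> Hom C B X \<and> q \<in> Hom C B Y \<and>
     p \<cdot>\<^bsub>C\<^esub> i = Ident C X \<and> q \<cdot>\<^bsub>C\<^esub> j = Ident C Y \<and>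
     p \<cdot>\<^bsub>C\<^esub> j = Zero C Y X \<and> q \<cdot>\<^bsub>C\<^esub> i = Zero C X Y \<and>
     Add C (i \<cdot>\<^bsub>C\<^esub> p) (j \<cdot>\<^bsub>C\<^esub> q) = Ident C B"

context preadditive_category
begin

lemma is_biproduct_imp_binary:
  assumes "is_biproduct C 2 X B \<iota> \<pi>"
  shows "is_binary_biproduct C (X 0) (X 1) B (\<iota> 0) (\<iota> 1) (\<pi> 0) (\<pi> 1)"
proof -
  have B: "B \<in> Obj C"
    and arrs: "\<And>k. k < 2 \<Longrightarrow> \<iota> k \<in> Hom C (X k) B \<and> \<pi> k \<in> Hom C B (X k)"
    and orth: "\<And>j k. j < 2 \<Longrightarrow> k < 2 \<Longrightarrow>
      \<pi> j \<cdot> \<iota> k = (if j = k then Ident C (X k) else Zero C (X k) (X j))"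
    and total: "finprod (Hom_group C B B) (\<lambda>k. \<iota> k \<cdot> \<pi> k) {..<2} = Ident C B"
    using assms unfolding is_biproduct_def by blast+
  interpret comm_group "Hom_group C B B" using B by (intro Hom_comm_group)
  have carrier: "\<iota> k \<cdot> \<pi> k \<in> carrier (Hom_group C B B)" if "k < 2" for k
    using arrs[OF that] Comp_in_Hom by (auto simp: Hom_group_def)
  have "{..<2::nat} = {0, 1}" by auto
  then have "finprod (Hom_group C B B) (\<lambda>k. \<iota> k \<cdot> \<pi> k) {..<2} =
      mult (Hom_group C B B) (\<iota> 0 \<cdot> \<pi> 0) (\<iota> 1 \<cdot> \<pi> 1)"
    using carrier[of 0] carrier[of 1] by simp
  then have "Add C (\<iota> 0 \<cdot> \<pi> 0) (\<iota> 1 \<cdot> \<pi> 1) = Ident C B"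
    using total by (simp add: Hom_group_def)
  then show ?thesis
    unfolding is_binary_biproduct_def using arrs[of 0] arrs[of 1] orth total by simp
qed

context
  fixes X Y B i j p q
  assumes biproduct: "is_binary_biproduct C X Y B i j p q"
begin

lemma binary_biproduct_arr:
  "i \<in> Arr C" "Dom C i = X" "Cod C i = B"
  "j \<in> Arr C" "Dom C j = Y" "Cod C j = B"
  "p \<in> Arr C" "Dom C p = B" "Cod C p = X"
  "q \<in> Arr C" "Dom C q = B" "Cod C q = Y"
  "X \<in> Obj C" "Y \<in> Obj C" "B \<in> Obj C"
  using biproduct Hom_Obj unfolding is_binary_biproduct_def by (auto simp: Hom_def)

lemma binary_biproduct_eq:
  "p \<cdot> i = Ident C X" "q \<cdot> j = Ident C Y" "p \<cdot> j = Zero C Y X" "q \<cdot> i = Zero C X Y"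
  using biproduct unfolding is_binary_biproduct_def by auto

lemma binary_biproduct_eq_Comp:
  assumes "x \<in> Arr C"
  shows "Cod C x = X \<Longrightarrow> p \<cdot> (i \<cdot> x) = x"
    "Cod C x = Y \<Longrightarrow> q \<cdot> (j \<cdot> x) = x"
    "Cod C x = Y \<Longrightarrow> p \<cdot> (j \<cdot> x) = Zero C (Dom C x) X"
    "Cod C x = X \<Longrightarrow> q \<cdot> (i \<cdot> x) = Zero C (Dom C x) Y"
  using assms binary_biproduct_arr binary_biproduct_eq by (simp_all add: Comp_reduce)

lemma binary_biproduct_decomp:
  assumes "u \<in> Arr C" "Dom C u = B"
  shows "Add C ((u \<cdot> i) \<cdot> p) ((u \<cdot> j) \<cdot> q) = u"
proof -
  note [simp] = binary_biproduct_arr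
  have "Add C ((u \<cdot> i) \<cdot> p) ((u \<cdot> j) \<cdot> q) = u \<cdot> Add C (i \<cdot> p) (j \<cdot> q)"
    using assms by (simp add: Comp_assoc_arr)
  then show ?thesis using biproduct assms unfolding is_binary_biproduct_def by simp
qed

text \<open>Because u = u (i p + j q), an arrow out of \<open>B\<close> is determined by its
  restrictions to the two summands. The uniqueness arguments for maps out of a biproduct rest on
  this.\<close>

lemma binary_biproduct_ext:
  assumes "u \<in> Arr C" "Dom C u = B" "v \<in> Arr C" "Dom C v = B" "u \<cdot> i = v \<cdot> i" "u \<cdot> j = v \<cdot> j"
  shows "u = v"
  using binary_biproduct_decomp[OF assms(1,2)] binary_biproduct_decomp[OF assms(3,4)]
  unfolding assms(5,6) by (rule trans[OF sym])

end

end

lemma (in additive_category) binary_biproduct_exists: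
  assumes "X \<in> Obj C" "Y \<in> Obj C"
  obtains B i j p q where "is_binary_biproduct C X Y B i j p q"
proof -
  have "\<exists>B \<iota> \<pi>. is_biproduct C 2 (\<lambda>k. if k = 0 then X else Y) B \<iota> \<pi>"
    using assms by (intro biproducts_exist) simp
  then obtain B \<iota> \<pi> where "is_biproduct C 2 (\<lambda>k. if k = 0 then X else Y) B \<iota> \<pi>"
    by blast
  from is_biproduct_imp_binary[OF this] show ?thesis by (auto intro: that)
qed

section \<open>The admissible monic of a pushout square\<close>

lemma is_pushout_universal:
  assumes "is_pushout C m f m' f'" "X \<in> Obj C" "a \<in> Hom C (Cod C f) X" "b \<in> Hom C (Cod C m) X"
    "a \<cdot>\<^bsub>C\<^esub> f = b \<cdot>\<^bsub>C\<^esub> m"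
  shows "\<exists>!u. u \<in> Hom C (Cod C m') X \<and> u \<cdot>\<^bsub>C\<^esub> m' = a \<and> u \<cdot>\<^bsub>C\<^esub> f' = b"
  using assms unfolding is_pushout_def by blast

lemma is_pushout_arr:
  assumes "is_pushout C m f m' f'"
  shows "m \<in> Arr C" "f \<in> Arr C" "m' \<in> Arr C" "f' \<in> Arr C" "Dom C m = Dom C f"
    "Dom C m' = Cod C f" "Dom C f' = Cod C m" "Cod C m' = Cod C f'"
    "m' \<cdot>\<^bsub>C\<^esub> f = f' \<cdot>\<^bsub>C\<^esub> m"
  using assms unfolding is_pushout_def by simp_all

context exact_category
begin

lemma E_is_kernel_cokernel:
  assumes "(i, p) \<in> E"
  shows "is_kernel C i p" "is_cokernel C p i"
  using E_kernel_cokernel[OF assms] unfolding kernel_cokernel_pair_def by auto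

lemma admissible_monic_arr: "admissible_monic E i \<Longrightarrow> i \<in> Arr C"
  using E_kernel_cokernel
  unfolding admissible_monic_def kernel_cokernel_pair_def is_kernel_def by blast

text \<open>Let \<open>z\<close> be the kernel of the identity of \<open>Y\<close>. Then z = 1 z =
  0, so the identity and the zero endomorphism of its source both lift \<open>z\<close> through
  itself; lifts are unique, hence they agree.\<close>

lemma admissible_monic_from_zero:
  assumes "Y \<in> Obj C"
  obtains z where "admissible_monic E z" "Cod C z = Y" "Ident C (Dom C z) = Zero C (Dom C z) (Dom C z)"
proof -
  obtain z where zE: "(z, Ident C Y) \<in> E"
    using Ident_admissible_epic[OF assms] unfolding admissible_epic_def by blast
  have k: "z \<in> Arr C" "Cod C z = Y" "Ident C Y \<cdot> z = Zero C (Dom C z) Y"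
    and univ: "\<And>X f. X \<in> Obj C \<Longrightarrow> f \<in> Hom C X Y \<Longrightarrow> Ident C Y \<cdot> f = Zero C X Y \<Longrightarrow>
        \<exists>!u. u \<in> Hom C X (Dom C z) \<and> z \<cdot> u = f"
    using E_is_kernel_cokernel(1)[OF zE] assms unfolding is_kernel_def by auto
  have z0: "z = Zero C (Dom C z) Y" using k by simp
  have D: "Dom C z \<in> Obj C" using k Dom_in_Obj by blast
  have "\<exists>!u. u \<in> Hom C (Dom C z) (Dom C z) \<and> z \<cdot> u = z"
    by (rule univ) (use k D in \<open>auto intro: HomI\<close>)
  moreover have "z \<cdot> Ident C (Dom C z) = z" using k D by simp
  moreover have "z \<cdot> Zero C (Dom C z) (Dom C z) = z" using k D z0 by simp
  ultimately have "Ident C (Dom C z) = Zero C (Dom C z) (Dom C z)"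
    using D HomI arr_Ident arr_Zero by metis
  then show ?thesis using that zE k unfolding admissible_monic_def by blast
qed

text \<open>
  Since \<open>B\<close> is also a coproduct with injections \<open>i + j f\<close> and \<open>j\<close>, the former is
  a pushout of the admissible monic \<open>0 \<rightarrow> Y\<close>.
\<close>
lemma graph_admissible_monic:
  assumes B: "is_binary_biproduct C X Y B i j p q" and f: "f \<in> Hom C X Y"
  shows "admissible_monic E (Add C i (j \<cdot> f))"
proof -
  note [simp] = binary_biproduct_arr[OF B] binary_biproduct_eq[OF B] binary_biproduct_eq_Comp[OF B]
    HomD[OF f] Comp_assoc_arr
  obtain z where z: "admissible_monic E z" "Cod C z = Y"
    and Id0: "Ident C (Dom C z) = Zero C (Dom C z) (Dom C z)"
    using admissible_monic_from_zero[OF binary_biproduct_arr(14)[OF B]] by blast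
  have z_arr [simp]: "z \<in> Arr C" using z admissible_monic_arr by blast
  have D [simp]: "Dom C z \<in> Obj C" by (simp add: Dom_in_Obj)
  \<comment> \<open>A zero identity makes the source of \<open>z\<close> initial, so any square
    starting there commutes.\<close>
  have from_zero: "h = Zero C (Dom C z) (Cod C h)" if "h \<in> Arr C" "Dom C h = Dom C z" for h
  proof -
    have "h = h \<cdot> Ident C (Dom C z)" using that by simp
    then show ?thesis unfolding Id0 using that by simp
  qed
  obtain g where g: "g \<in> Hom C X Y" "Add C f g = Zero C X Y" "Add C g f = Zero C X Y"
    using f by (rule negative_exists)
  note [simp] = HomD[OF g(1)]
  let ?w = "Zero C (Dom C z) X"
  have "is_pushout C z ?w (Add C i (j \<cdot> f)) j"
    unfolding is_pushout_def
  proof (intro conjI ballI impI)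
    show "Add C i (j \<cdot> f) \<cdot> ?w = j \<cdot> z"
      using from_zero[of "j \<cdot> z"] z by simp
  next
    fix T a b
    assume T: "T \<in> Obj C" and "a \<in> Hom C (Cod C ?w) T" "b \<in> Hom C (Cod C z) T"
    then have [simp]: "a \<in> Arr C" "Dom C a = X" "Cod C a = T" "b \<in> Arr C" "Dom C b = Y" "Cod C b = T"
      using z by (auto simp: Hom_def)
    \<comment> \<open>The conditions u j = b and u (i + j f) = a force u i = a - b f, which is
      \<open>?c\<close> since \<open>g\<close> is the negative of \<open>f\<close>.\<close>
    let ?c = "Add C a (b \<cdot> g)"
    let ?u = "Add C (?c \<cdot> p) (b \<cdot> q)"
    have "Add C ?c (b \<cdot> f) = Add C a (Add C (b \<cdot> g) (b \<cdot> f))"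
      by (rule Add_assoc[of _ X T]) (auto intro: HomI)
    also have "Add C (b \<cdot> g) (b \<cdot> f) = b \<cdot> Add C g f" by simp
    finally have c: "Add C ?c (b \<cdot> f) = a" using g T by simp
    show "\<exists>!u. u \<in> Hom C (Cod C (Add C i (j \<cdot> f))) T \<and> u \<cdot> Add C i (j \<cdot> f) = a \<and> u \<cdot> j = b"
    proof (rule ex1I[of _ ?u])
      have ui: "?u \<cdot> i = ?c" and uj: "?u \<cdot> j = b" using T by simp_all
      have "?u \<cdot> Add C i (j \<cdot> f) = Add C (?u \<cdot> i) ((?u \<cdot> j) \<cdot> f)"
        by (subst Comp_Add_right_arr) (simp_all add: Comp_assoc_arr del: Comp_Add_left_arr)
      then show "?u \<in> Hom C (Cod C (Add C i (j \<cdot> f))) T \<and> ?u \<cdot> Add C i (j \<cdot> f) = a \<and> ?u \<cdot> j = b"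
        using ui uj c by (auto intro!: HomI)
      fix u assume u: "u \<in> Hom C (Cod C (Add C i (j \<cdot> f))) T \<and> u \<cdot> Add C i (j \<cdot> f) = a \<and> u \<cdot> j = b"
      then have [simp]: "u \<in> Arr C" "Dom C u = B" "Cod C u = T" by (auto simp: Hom_def)
      have "Add C (u \<cdot> i) (b \<cdot> f) = a"
        using u Comp_reduce[of u j b f] by (simp)
      then have ui': "u \<cdot> i = ?u \<cdot> i"
        unfolding ui using c Add_right_cancel[of "u \<cdot> i" X T ?c "b \<cdot> f"] by (simp add: Hom_def)
      have uj': "u \<cdot> j = ?u \<cdot> j" using u uj by metis
      show "u = ?u" by (rule binary_biproduct_ext[OF B _ _ _ _ ui' uj']) simp_all
    qed
  qed (use z in auto)
  then show ?thesis using pushout_admissible_monic z by blast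
qed

text \<open>\<open>m \<oplus> 1\<close> is the pushout of \<open>m\<close> along the inclusion \<open>i\<close>.\<close>
lemma biproduct_map_admissible_monic:
  assumes B: "is_binary_biproduct C (Dom C m) Y B i j p q"
    and B': "is_binary_biproduct C (Cod C m) Y B' i' j' p' q'"
    and m: "admissible_monic E m"
  shows "admissible_monic E (Add C ((i' \<cdot> m) \<cdot> p) (j' \<cdot> q))"
proof -
  note [simp] = binary_biproduct_arr[OF B] binary_biproduct_eq[OF B] binary_biproduct_eq_Comp[OF B]
    binary_biproduct_arr[OF B'] binary_biproduct_eq[OF B'] binary_biproduct_eq_Comp[OF B']
    admissible_monic_arr[OF m] Comp_assoc_arr
  let ?k = "Add C ((i' \<cdot> m) \<cdot> p) (j' \<cdot> q)"
  have "is_pushout C m i ?k i'"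
    unfolding is_pushout_def
  proof (intro conjI ballI impI)
    fix T a b
    assume T: "T \<in> Obj C" and "a \<in> Hom C (Cod C i) T" "b \<in> Hom C (Cod C m) T"
      and eq: "a \<cdot> i = b \<cdot> m"
    then have [simp]: "a \<in> Arr C" "Dom C a = B" "Cod C a = T"
      "b \<in> Arr C" "Dom C b = Cod C m" "Cod C b = T"
      by (auto simp: Hom_def)
    \<comment> \<open>The value on \<open>i'\<close> is prescribed to be \<open>b\<close>; the value
      on \<open>j'\<close> is forced to be \<open>a \<cdot> j\<close>, because
      \<open>?k \<cdot> j = j'\<close>.\<close>
    let ?u = "Add C (b \<cdot> p') ((a \<cdot> j) \<cdot> q')"
    show "\<exists>!u. u \<in> Hom C (Cod C ?k) T \<and> u \<cdot> ?k = a \<and> u \<cdot> i' = b"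
    proof (rule ex1I[of _ ?u])
      have "?u \<cdot> ?k = a"
        by (rule binary_biproduct_ext[OF B]) (use T eq in simp_all)
      then show "?u \<in> Hom C (Cod C ?k) T \<and> ?u \<cdot> ?k = a \<and> ?u \<cdot> i' = b"
        using T by (auto intro!: HomI)
      fix u assume u: "u \<in> Hom C (Cod C ?k) T \<and> u \<cdot> ?k = a \<and> u \<cdot> i' = b"
      then have [simp]: "u \<in> Arr C" "Dom C u = B'" "Cod C u = T" by (auto simp: Hom_def)
      have "a \<cdot> j = (u \<cdot> ?k) \<cdot> j" using u by simp
      also have "\<dots> = u \<cdot> (?k \<cdot> j)" by (rule Comp_assoc_arr) simp_all
      also have "?k \<cdot> j = j'" by simp
      finally have uj: "u \<cdot> j' = ?u \<cdot> j'" using T by simp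
      have ui: "u \<cdot> i' = ?u \<cdot> i'" using u T by simp
      show "u = ?u" by (rule binary_biproduct_ext[OF B' _ _ _ _ ui uj]) simp_all
    qed
  qed (auto)
  then show ?thesis using pushout_admissible_monic m by blast
qed

text \<open>No sign appears here: the negative of the span's second leg is substituted for
  \<open>f\<close> on application. The factorisation passes through an auxiliary biproduct
  \<open>B'\<close> of \<open>Dom C m\<close> and \<open>Y\<close>, where the graph of
  \<open>f\<close> lands and \<open>?k\<close> departs.\<close>

lemma admissible_monic_pair:
  assumes B: "is_binary_biproduct C (Cod C m) Y B i j p q"
    and m: "admissible_monic E m" and f: "f \<in> Hom C (Dom C m) Y"
  shows "admissible_monic E (Add C (i \<cdot> m) (j \<cdot> f))"
proof -
  note [simp] = binary_biproduct_arr[OF B] HomD[OF f] admissible_monic_arr[OF m] Comp_assoc_arr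
  obtain B' i' j' p' q' where B': "is_binary_biproduct C (Dom C m) Y B' i' j' p' q'"
    using binary_biproduct_exists[of "Dom C m" Y] Dom_in_Obj[of m] by (metis m f Hom_Obj)
  note [simp] = binary_biproduct_arr[OF B'] binary_biproduct_eq[OF B'] binary_biproduct_eq_Comp[OF B']
  let ?k = "Add C ((i \<cdot> m) \<cdot> p') (j \<cdot> q')"
  have "admissible_monic E (?k \<cdot> Add C i' (j' \<cdot> f))"
    using biproduct_map_admissible_monic[OF B' B m] graph_admissible_monic[OF B' f]
    by (intro admissible_monic_Comp) simp_all
  also have "?k \<cdot> Add C i' (j' \<cdot> f) = Add C (i \<cdot> m) (j \<cdot> f)" by simp
  finally show ?thesis .
qed

text \<open>Some \<open>(m, p)\<close> lies in \<open>E\<close>. Two cokernels of \<open>m\<close>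
  differ by an isomorphism \<open>u\<close> of their targets, and (1, 1, u) is then an isomorphism
  of sequences, under which \<open>E\<close> is closed.\<close>

lemma E_if_cokernel:
  assumes m: "admissible_monic E m" and q: "is_cokernel C q m"
  shows "(m, q) \<in> E"
proof -
  obtain p where pE: "(m, p) \<in> E" using m unfolding admissible_monic_def by blast
  have p: "is_cokernel C p m" using E_is_kernel_cokernel pE by blast
  have [simp]: "m \<in> Arr C" "p \<in> Arr C" "q \<in> Arr C" "Dom C p = Cod C m" "Dom C q = Cod C m"
    using p q unfolding is_cokernel_def by auto
  have [simp]: "Dom C m \<in> Obj C" "Cod C m \<in> Obj C" "Cod C p \<in> Obj C" "Cod C q \<in> Obj C"
    using Dom_in_Obj Cod_in_Obj by auto
  \<comment> \<open>A cokernel is epic: \<open>v \<cdot> r\<close> kills \<open>m\<close>, so its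
    factorisation through \<open>r\<close> is unique. This makes the two comparison arrows below
    mutually inverse.\<close>
  have unique: "u = v"
    if "is_cokernel C r m" "u \<in> Hom C (Cod C r) T" "v \<in> Hom C (Cod C r) T" "u \<cdot> r = v \<cdot> r" for r u v T
  proof -
    have r: "r \<in> Arr C" "Dom C r = Cod C m" "r \<cdot> m = Zero C (Dom C m) (Cod C r)"
      using that unfolding is_cokernel_def by auto
    have T: "T \<in> Obj C" using that Hom_Obj by blast
    have "(v \<cdot> r) \<cdot> m = Zero C (Dom C m) T"
      using r that by (simp add: Comp_assoc_arr Hom_def)
    moreover have "v \<cdot> r \<in> Hom C (Cod C m) T" using r that by (auto simp: Hom_def)
    ultimately have "\<exists>!u. u \<in> Hom C (Cod C r) T \<and> u \<cdot> r = v \<cdot> r"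
      using that(1) T unfolding is_cokernel_def by blast
    then show ?thesis using that by blast
  qed
  obtain u where u: "u \<in> Hom C (Cod C p) (Cod C q)" "u \<cdot> p = q"
    using p q unfolding is_cokernel_def by (metis HomI \<open>Cod C q \<in> Obj C\<close>)
  obtain v where v: "v \<in> Hom C (Cod C q) (Cod C p)" "v \<cdot> q = p"
    using p q unfolding is_cokernel_def by (metis HomI \<open>Cod C p \<in> Obj C\<close>)
  note [simp] = HomD[OF u(1)] HomD[OF v(1)]
  have "v \<cdot> u = Ident C (Cod C p)"
    using p by (rule unique) (auto simp: u v Comp_assoc_arr intro: HomI)
  moreover have "u \<cdot> v = Ident C (Cod C q)"
    using q by (rule unique) (auto simp: u v Comp_assoc_arr intro: HomI)
  ultimately have "is_iso C u (Cod C p) (Cod C q)"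
    using u v unfolding is_iso_def by blast
  then show ?thesis
    using pE u is_iso_Ident
      E_iso_closed[of m p m "Dom C m" "Cod C m" q "Cod C q" "Ident C (Dom C m)" "Ident C (Cod C m)" u]
    by (simp add: Hom_def)
qed

text \<open>An arrow x out of \<open>B\<close> is a pair (x i, x j), and since \<open>g\<close> is
  the negative of \<open>f\<close>, killing (m, g) means x i m = x j f. So arrows killing it are
  exactly cocones on the span, and the two universal properties coincide.\<close>

lemma pushout_cokernel:
  assumes B: "is_binary_biproduct C (Cod C m) (Cod C f) B i j p q"
    and P: "is_pushout C m f m' f'"
    and g: "g \<in> Hom C (Dom C f) (Cod C f)" "Add C f g = Zero C (Dom C f) (Cod C f)"
      "Add C g f = Zero C (Dom C f) (Cod C f)"
  shows "is_cokernel C (Add C (f' \<cdot> p) (m' \<cdot> q)) (Add C (i \<cdot> m) (j \<cdot> g))"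
proof -
  note [simp] = is_pushout_arr(1-8)[OF P]
  note comm = is_pushout_arr(9)[OF P] and univ = is_pushout_universal[OF P]
  note [simp] = binary_biproduct_arr[OF B] binary_biproduct_eq[OF B] binary_biproduct_eq_Comp[OF B]
    HomD[OF g(1)] Comp_assoc_arr
  have [simp]: "Dom C f \<in> Obj C" "Cod C f' \<in> Obj C" using Dom_in_Obj Cod_in_Obj by auto
  let ?q = "Add C (f' \<cdot> p) (m' \<cdot> q)" and ?s = "Add C (i \<cdot> m) (j \<cdot> g)"
  have qi: "?q \<cdot> i = f'" and qj: "?q \<cdot> j = m'" by simp_all
  show ?thesis unfolding is_cokernel_def
  proof (intro conjI ballI impI)
    have "?q \<cdot> ?s = Add C (m' \<cdot> f) (m' \<cdot> g)" using comm by simp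
    also have "\<dots> = m' \<cdot> Add C f g" by simp
    finally show "?q \<cdot> ?s = Zero C (Dom C ?s) (Cod C ?q)" using g by simp
  next
    fix T x assume T: "T \<in> Obj C" and x: "x \<in> Hom C (Cod C ?s) T" and xs: "x \<cdot> ?s = Zero C (Dom C ?s) T"
    then have [simp]: "x \<in> Arr C" "Dom C x = B" "Cod C x = T" by (auto simp: Hom_def)
    \<comment> \<open>Both \<open>(x \<cdot> j) \<cdot> f\<close> and
      \<open>(x \<cdot> i) \<cdot> m\<close> become zero when \<open>(x \<cdot> j) \<cdot> g\<close>
      is added, the latter by \<open>xs\<close>; cancelling gives the cocone condition.\<close>
    have "Add C ((x \<cdot> j) \<cdot> f) ((x \<cdot> j) \<cdot> g) = (x \<cdot> j) \<cdot> Add C f g" by (subst Comp_Add_right_arr) simp_all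
    then have "Add C ((x \<cdot> j) \<cdot> f) ((x \<cdot> j) \<cdot> g) = Zero C (Dom C f) T" using g T by simp
    then have "(x \<cdot> j) \<cdot> f = (x \<cdot> i) \<cdot> m"
      using xs Add_right_cancel[of "(x \<cdot> j) \<cdot> f" "Dom C f" T "(x \<cdot> i) \<cdot> m" "(x \<cdot> j) \<cdot> g"]
      by (simp add: Hom_def)
    moreover have "x \<cdot> j \<in> Hom C (Cod C f) T" "x \<cdot> i \<in> Hom C (Cod C m) T" by (auto intro!: HomI)
    ultimately have ex1: "\<exists>!u. u \<in> Hom C (Cod C m') T \<and> u \<cdot> m' = x \<cdot> j \<and> u \<cdot> f' = x \<cdot> i"
      using univ T by blast
    \<comment> \<open>Testing \<open>u \<cdot> ?q = x\<close> on the two injections turns it into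
      the two pushout equations, so unique existence carries over.\<close>
    have "u \<cdot> ?q = x \<longleftrightarrow> u \<cdot> m' = x \<cdot> j \<and> u \<cdot> f' = x \<cdot> i" if "u \<in> Hom C (Cod C m') T" for u
    proof -
      note [simp] = HomD[OF that]
      have "(u \<cdot> ?q) \<cdot> j = u \<cdot> m'" "(u \<cdot> ?q) \<cdot> i = u \<cdot> f'"
        using qi qj Comp_assoc_arr[of j ?q u] Comp_assoc_arr[of i ?q u] by simp_all
      moreover have "u \<cdot> ?q = x \<longleftrightarrow> (u \<cdot> ?q) \<cdot> i = x \<cdot> i \<and> (u \<cdot> ?q) \<cdot> j = x \<cdot> j"
        using binary_biproduct_ext[OF B, of "u \<cdot> ?q" x] by auto
      ultimately show ?thesis by metis
    qed
    then show "\<exists>!u. u \<in> Hom C (Cod C ?q) T \<and> u \<cdot> ?q = x" using ex1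
      by (simp cong: conj_cong)
  qed (auto)
qed

text \<open>The cokernel moves along: with v inverse to \<open>u\<close>, the pair (u m, p v) is
  isomorphic to (m, p) through (1, u, 1).\<close>

lemma admissible_monic_iso_Comp:
  assumes m: "admissible_monic E m" and u: "is_iso C u (Cod C m) Y"
  shows "admissible_monic E (u \<cdot> m)"
proof -
  obtain p where pE: "(m, p) \<in> E" using m unfolding admissible_monic_def by blast
  have [simp]: "m \<in> Arr C" "p \<in> Arr C" "Dom C p = Cod C m"
    using E_is_kernel_cokernel(1)[OF pE] unfolding is_kernel_def by auto
  obtain v where uv: "u \<in> Hom C (Cod C m) Y" "v \<in> Hom C Y (Cod C m)" "v \<cdot> u = Ident C (Cod C m)"
    using u unfolding is_iso_def by blast
  note [simp] = HomD[OF uv(1)] HomD[OF uv(2)]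
  have "(u \<cdot> m, p \<cdot> v) \<in> E"
    by (rule E_iso_closed[OF pE, of _ "Dom C m" Y _ "Cod C p" "Ident C (Dom C m)" u "Ident C (Cod C p)"])
      (use u in \<open>simp_all add: Hom_def is_iso_Ident Dom_in_Obj Cod_in_Obj Comp_assoc_arr uv\<close>)
  then show ?thesis unfolding admissible_monic_def by blast
qed

end

text \<open>Stated for a bare category because it is applied inside the subcategory before that is
  known to be exact.\<close>

lemma (in category) pushout_iso:
  assumes P: "is_pushout C m f m1 f1" and Q: "is_pushout C m f m2 f2"
  obtains u where "is_iso C u (Cod C m1) (Cod C m2)" "u \<cdot> m1 = m2"
proof -
  note P_arr = is_pushout_arr[OF P] and Q_arr = is_pushout_arr[OF Q]
  let ?X = "Cod C m1" and ?Y = "Cod C m2"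
  have X: "?X \<in> Obj C" and Y: "?Y \<in> Obj C" using P_arr Q_arr Cod_in_Obj by auto
  have P_legs: "m1 \<in> Hom C (Cod C f) ?X" "f1 \<in> Hom C (Cod C m) ?X"
    and Q_legs: "m2 \<in> Hom C (Cod C f) ?Y" "f2 \<in> Hom C (Cod C m) ?Y"
    using P_arr Q_arr by (simp_all add: Hom_def)
  obtain u where u: "u \<in> Hom C ?X ?Y" "u \<cdot> m1 = m2" "u \<cdot> f1 = f2"
    using is_pushout_universal[OF P Y Q_legs Q_arr(9)] by blast
  obtain v where v: "v \<in> Hom C ?Y ?X" "v \<cdot> m2 = m1" "v \<cdot> f2 = f1"
    using is_pushout_universal[OF Q X P_legs P_arr(9)] by blast
  note u_arr = HomD[OF u(1)] and v_arr = HomD[OF v(1)]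
  have "v \<cdot> u \<in> Hom C ?X ?X \<and> (v \<cdot> u) \<cdot> m1 = m1 \<and> (v \<cdot> u) \<cdot> f1 = f1"
    using P_arr u_arr v_arr by (simp add: Hom_def Comp_assoc_arr u v)
  moreover have "Ident C ?X \<in> Hom C ?X ?X \<and> Ident C ?X \<cdot> m1 = m1 \<and> Ident C ?X \<cdot> f1 = f1"
    using P_arr X by (simp add: Hom_def)
  ultimately have vu: "v \<cdot> u = Ident C ?X"
    using is_pushout_universal[OF P X P_legs P_arr(9)] by blast
  have "u \<cdot> v \<in> Hom C ?Y ?Y \<and> (u \<cdot> v) \<cdot> m2 = m2 \<and> (u \<cdot> v) \<cdot> f2 = f2"
    using Q_arr u_arr v_arr by (simp add: Hom_def Comp_assoc_arr u v)
  moreover have "Ident C ?Y \<in> Hom C ?Y ?Y \<and> Ident C ?Y \<cdot> m2 = m2 \<and> Ident C ?Y \<cdot> f2 = f2"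
    using Q_arr Y by (simp add: Hom_def)
  ultimately have uv: "u \<cdot> v = Ident C ?Y"
    using is_pushout_universal[OF Q Y Q_legs Q_arr(9)] by blast
  have "is_iso C u ?X ?Y" using u v uv vu unfolding is_iso_def by blast
  then show ?thesis using u(2) by (rule that)
qed

section \<open>The opposite exact category\<close>

text \<open>\<open>Zero\<close> swaps its arguments because they name source and target. Applying
  the construction twice returns the same record, so one implication between a notion and its dual
  yields the other.\<close>

definition op_cat :: "('o, 'm) cat \<Rightarrow> ('o, 'm) cat" where
  "op_cat C = \<lparr>Obj = Obj C, Arr = Arr C, Dom = Cod C, Cod = Dom C, Ident = Ident C,
     Comp = (\<lambda>g f. f \<cdot>\<^bsub>C\<^esub> g), Add = Add C, Zero = (\<lambda>X Y. Zero C Y X)\<rparr>"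

lemma op_cat_simps [simp]:
  "Obj (op_cat C) = Obj C" "Arr (op_cat C) = Arr C" "Dom (op_cat C) = Cod C" "Cod (op_cat C) = Dom C"
  "Ident (op_cat C) = Ident C" "g \<cdot>\<^bsub>op_cat C\<^esub> f = f \<cdot>\<^bsub>C\<^esub> g" "Add (op_cat C) = Add C"
  "Zero (op_cat C) X Y = Zero C Y X"
  by (simp_all add: op_cat_def)

lemma op_cat_op_cat [simp]: "op_cat (op_cat C) = C"
  by (rule cat.equality) (simp_all add: op_cat_def)

lemma Hom_op_cat [simp]: "Hom (op_cat C) X Y = Hom C Y X"
  by (auto simp: Hom_def)

lemma Hom_group_op_cat [simp]: "Hom_group (op_cat C) X Y = Hom_group C Y X"
  by (simp add: Hom_group_def)

lemma is_kernel_op_cat [simp]: "is_kernel (op_cat C) p i \<longleftrightarrow> is_cokernel C p i"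
  unfolding is_kernel_def is_cokernel_def by auto

lemma is_cokernel_op_cat [simp]: "is_cokernel (op_cat C) i p \<longleftrightarrow> is_kernel C i p"
  unfolding is_kernel_def is_cokernel_def by auto

lemma is_pushout_op_cat [simp]: "is_pushout (op_cat C) p f p' f' \<longleftrightarrow> is_pullback C p f p' f'"
  unfolding is_pushout_def is_pullback_def by simp

lemma is_pullback_op_cat [simp]: "is_pullback (op_cat C) i f i' f' \<longleftrightarrow> is_pushout C i f i' f'"
  unfolding is_pushout_def is_pullback_def by simp

lemma is_biproduct_op_cat:
  assumes "is_biproduct C n X B \<iota> \<pi>"
  shows "is_biproduct (op_cat C) n X B \<pi> \<iota>"
  using assms unfolding is_biproduct_def by auto

lemma is_iso_op_cat: "is_iso (op_cat C) f X Y \<longleftrightarrow> is_iso C f Y X"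
  unfolding is_iso_def by auto

lemma admissible_converse [simp]:
  "admissible_monic (E\<inverse>) p \<longleftrightarrow> admissible_epic E p"
  "admissible_epic (E\<inverse>) i \<longleftrightarrow> admissible_monic E i"
  unfolding admissible_monic_def admissible_epic_def by auto

lemma (in category) category_op_cat: "category (op_cat C)"
  by unfold_locales
    (auto simp: Dom_in_Obj Cod_in_Obj intro: Ident_in_Hom Comp_in_Hom Comp_Ident Ident_Comp
      Comp_assoc[symmetric])

lemma (in additive_category) additive_op_cat: "additive_category (op_cat C)"
proof -
  show ?thesis
  proof (intro additive_category.intro preadditive_category.intro category_op_cat
      preadditive_category_axioms.intro additive_category_axioms.intro)
    fix n and X :: "nat \<Rightarrow> 'a"
    assume "\<And>k. k < n \<Longrightarrow> X k \<in> Obj (op_cat C)"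
    then have "\<exists>B \<iota> \<pi>. is_biproduct C n X B \<iota> \<pi>" by (intro biproducts_exist) simp
    then obtain B \<iota> \<pi> where "is_biproduct C n X B \<iota> \<pi>" by blast
    from is_biproduct_op_cat[OF this] show "\<exists>B \<iota> \<pi>. is_biproduct (op_cat C) n X B \<iota> \<pi>" by blast
  qed (simp_all add: Hom_comm_group Comp_Add_left Comp_Add_right)
qed

text \<open>Closure under isomorphism is the axiom that takes work: reversal makes \<open>a\<close>,
  \<open>b\<close>, \<open>c\<close> point towards the given pair instead of away from it, so their
  inverses must be used and both squares turned around. The remaining axioms hold as they stand or
  are exchanged in dual pairs.\<close>

lemma (in exact_category) exact_op_cat: "exact_category (op_cat C) (E\<inverse>)"
proof -
  interpret op: additive_category "op_cat C" by (rule additive_op_cat)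
  have inverse: "\<exists>g. is_iso C g Y X \<and> g \<cdot> f = Ident C X \<and> f \<cdot> g = Ident C Y" if "is_iso C f X Y" for f X Y
    using that unfolding is_iso_def by blast
  show ?thesis
  proof unfold_locales
    fix i p i' p' M' N' L' a b c
    assume ip: "(i, p) \<in> E\<inverse>" and i': "i' \<in> Hom (op_cat C) M' N'" and p': "p' \<in> Hom (op_cat C) N' L'"
      and a: "is_iso (op_cat C) a (Dom (op_cat C) i) M'"
      and b: "is_iso (op_cat C) b (Cod (op_cat C) i) N'"
      and c: "is_iso (op_cat C) c (Cod (op_cat C) p) L'"
      and bi: "b \<cdot>\<^bsub>op_cat C\<^esub> i = i' \<cdot>\<^bsub>op_cat C\<^esub> a" and cp: "c \<cdot>\<^bsub>op_cat C\<^esub> p = p' \<cdot>\<^bsub>op_cat C\<^esub> b"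
    have E: "(p, i) \<in> E" using ip by simp
    then have [simp]: "i \<in> Arr C" "p \<in> Arr C" "Cod C p = Dom C i"
      using E_is_kernel_cokernel(1)[OF E] unfolding is_kernel_def by auto
    have a: "is_iso C a M' (Cod C i)" and b: "is_iso C b N' (Dom C i)" and c: "is_iso C c L' (Dom C p)"
      using a b c by (simp_all add: is_iso_op_cat)
    obtain a' where a': "is_iso C a' (Cod C i) M'" "a' \<cdot> a = Ident C M'" "a \<cdot> a' = Ident C (Cod C i)"
      using inverse[OF a] by blast
    obtain b' where b': "is_iso C b' (Dom C i) N'" "b' \<cdot> b = Ident C N'" "b \<cdot> b' = Ident C (Dom C i)"
      using inverse[OF b] by blast
    obtain c' where c': "is_iso C c' (Dom C p) L'" "c' \<cdot> c = Ident C L'" "c \<cdot> c' = Ident C (Dom C p)"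
      using inverse[OF c] by blast
    have isoD: "f \<in> Arr C" "Dom C f = X" "Cod C f = Y" if "is_iso C f X Y" for f X Y
      using that unfolding is_iso_def by (auto simp: Hom_def)
    note [simp] = isoD[OF a'(1)] isoD[OF b'(1)] isoD[OF c'(1)]
isoD[OF a] isoD[OF b] isoD[OF c]
    have [simp]: "i' \<in> Arr C" "Dom C i' = N'" "Cod C i' = M'" "p' \<in> Arr C" "Dom C p' = L'" "Cod C p' = N'"
      using i' p' by (auto simp: Hom_def)
    have bi: "i \<cdot> b = a \<cdot> i'" and cp: "p \<cdot> c = b \<cdot> p'" using bi cp by auto
    \<comment> \<open>Turning a square around: insert \<open>x' \<cdot> x\<close> to the right of
      \<open>f\<close>, use the given square, and cancel \<open>y \<cdot> y'\<close>.\<close>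
    have transport: "y \<cdot> f = f' \<cdot> x"
      if "f \<cdot> x' = y' \<cdot> f'" "x' \<cdot> x = Ident C (Dom C f)" "y \<cdot> y' = Ident C (Cod C f')"
        "f \<in> Arr C" "f' \<in> Arr C" "x \<in> Arr C" "x' \<in> Arr C" "y \<in> Arr C" "y' \<in> Arr C"
        "Dom C x = Dom C f" "Cod C x = Dom C f'" "Dom C x' = Dom C f'" "Cod C x' = Dom C f"
        "Dom C y = Cod C f" "Cod C y = Cod C f'" "Dom C y' = Cod C f'" "Cod C y' = Cod C f"
      for f f' x x' y y'
    proof -
      have "y \<cdot> f = y \<cdot> (f \<cdot> (x' \<cdot> x))" using that by simp
      also have "\<dots> = y \<cdot> ((f \<cdot> x') \<cdot> x)" using that(4-) by (simp add: Comp_assoc_arr)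
      also have "\<dots> = (y \<cdot> y') \<cdot> (f' \<cdot> x)" unfolding that(1) using that(4-) by (simp add: Comp_assoc_arr)
      also have "\<dots> = f' \<cdot> x" using that by simp
      finally show ?thesis .
    qed
    have "(p', i') \<in> E"
    proof (rule E_iso_closed[OF E _ _ c'(1) _ a'(1)])
      show "b' \<cdot> p = p' \<cdot> c'" by (rule transport[OF cp]) (simp_all add: b' c')
      show "a' \<cdot> i = i' \<cdot> b'" by (rule transport[OF bi]) (simp_all add: a' b')
    qed (use b' i' p' in simp_all)
    then show "(i', p') \<in> E\<inverse>" by simp
  next
    fix i p assume "(i, p) \<in> E\<inverse>"
    then show "kernel_cokernel_pair (op_cat C) i p"
      using E_kernel_cokernel[of p i] unfolding kernel_cokernel_pair_def by simp
  qed (auto intro: Ident_admissible_monic Ident_admissible_epic admissible_monic_Comp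
      admissible_epic_Comp pushout_admissible_monic pullback_admissible_epic
      simp: pushout_exists pullback_exists)
qed

section \<open>Full subcategories closed under admissible subobjects and quotients\<close>

lemma full_subcategory_on_simps [simp]:
  "Obj (full_subcategory_on C S) = S"
  "Arr (full_subcategory_on C S) = {f \<in> Arr C. Dom C f \<in> S \<and> Cod C f \<in> S}"
  "Dom (full_subcategory_on C S) = Dom C" "Cod (full_subcategory_on C S) = Cod C"
  "Ident (full_subcategory_on C S) = Ident C" "Comp (full_subcategory_on C S) = Comp C"
  "Add (full_subcategory_on C S) = Add C" "Zero (full_subcategory_on C S) = Zero C"
  by (simp_all add: full_subcategory_on_def)

lemma Hom_full_subcategory_on:
  "f \<in> Hom (full_subcategory_on C S) X Y \<longleftrightarrow> f \<in> Hom C X Y \<and> X \<in> S \<and> Y \<in> S"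
  by (auto simp: Hom_def)

lemma Hom_group_full_subcategory_on:
  "X \<in> S \<Longrightarrow> Y \<in> S \<Longrightarrow> Hom_group (full_subcategory_on C S) X Y = Hom_group C X Y"
  by (auto simp: Hom_group_def Hom_def)

text \<open>Fewer objects remain to be tested, and by fullness the mediating arrows already lie in
  the subcategory.\<close>

lemma is_pushout_full_subcategory_on:
  assumes "is_pushout C m f m' f'" "S \<subseteq> Obj C" "Dom C m \<in> S" "Cod C m \<in> S" "Cod C f \<in> S" "Cod C m' \<in> S"
  shows "is_pushout (full_subcategory_on C S) m f m' f'"
  unfolding is_pushout_def
proof (intro conjI ballI impI)
  fix X a b
  assume "X \<in> Obj (full_subcategory_on C S)"
    "a \<in> Hom (full_subcategory_on C S) (Cod (full_subcategory_on C S) f) X"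
    "b \<in> Hom (full_subcategory_on C S) (Cod (full_subcategory_on C S) m) X"
    "a \<cdot>\<^bsub>full_subcategory_on C S\<^esub> f = b \<cdot>\<^bsub>full_subcategory_on C S\<^esub> m"
  then show "\<exists>!u. u \<in> Hom (full_subcategory_on C S) (Cod (full_subcategory_on C S) m') X \<and>
      u \<cdot>\<^bsub>full_subcategory_on C S\<^esub> m' = a \<and> u \<cdot>\<^bsub>full_subcategory_on C S\<^esub> f' = b"
    using is_pushout_universal[OF assms(1), of X a b] assms(2-)
    by (auto simp only: Hom_full_subcategory_on full_subcategory_on_simps)
qed (use assms is_pushout_arr[OF assms(1)] in simp_all)

lemma is_biproduct_full_subcategory_on:
  assumes "is_biproduct C n X B \<iota> \<pi>" "B \<in> S" "\<And>k. k < n \<Longrightarrow> X k \<in> S"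
  shows "is_biproduct (full_subcategory_on C S) n X B \<iota> \<pi>"
  using assms unfolding is_biproduct_def
  by (simp add: Hom_full_subcategory_on Hom_group_full_subcategory_on)

lemma op_cat_full_subcategory_on:
  "full_subcategory_on (op_cat C) S = op_cat (full_subcategory_on C S)"
  by (auto simp: full_subcategory_on_def op_cat_def)

text \<open>The conditions on \<open>S\<close> are self-dual, so every result for monics also yields
  one for epics. \<open>S_biproduct\<close> ranges over all biproducts of a family: n = 0 puts the
  zero objects in \<open>S\<close>, and n = 1 gives closure under isomorphism.\<close>

locale admissibly_closed = exact_category +
  fixes S :: "'a set"
  assumes S_subset: "S \<subseteq> Obj C"
    and S_biproduct: "is_biproduct C n X B \<iota> \<pi> \<Longrightarrow> (\<And>k. k < n \<Longrightarrow> X k \<in> S) \<Longrightarrow> B \<in> S"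
    and S_admissible: "(i, p) \<in> E \<Longrightarrow> Cod C i \<in> S \<Longrightarrow> Dom C i \<in> S \<and> Cod C p \<in> S"
begin

abbreviation D where "D \<equiv> full_subcategory_on C S"
abbreviation E' where "E' \<equiv> restrict_sequences C E S"

lemma op_cat_admissibly_closed: "admissibly_closed (op_cat C) (E\<inverse>) S"
proof -
  interpret op: exact_category "op_cat C" "E\<inverse>" by (rule exact_op_cat)
  show ?thesis
  proof unfold_locales
    fix i p assume ip: "(i, p) \<in> E\<inverse>" and S: "Cod (op_cat C) i \<in> S"
    have E: "(p, i) \<in> E" using ip by simp
    have "Cod C p = Dom C i"
      using E_is_kernel_cokernel(1)[OF E] unfolding is_kernel_def by auto
    then show "Dom (op_cat C) i \<in> S \<and> Cod (op_cat C) p \<in> S" using S_admissible[OF E] S by simp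
  next
    fix n X B \<iota> \<pi> assume "is_biproduct (op_cat C) n X B \<iota> \<pi>" and X: "\<And>k. k < n \<Longrightarrow> X k \<in> S"
    then have "is_biproduct C n X B \<pi> \<iota>"
      using is_biproduct_op_cat[of "op_cat C" n X B \<iota> \<pi>] by simp
    then show "B \<in> S" using X by (rule S_biproduct)
  qed (use S_subset in simp)
qed

lemma restrict_sequences_op_cat: "restrict_sequences (op_cat C) (E\<inverse>) S = E'\<inverse>"
proof -
  have "Cod C i = Dom C p" if "(i, p) \<in> E" for i p
    using E_is_kernel_cokernel(1)[OF that] unfolding is_kernel_def by auto
  then show ?thesis unfolding restrict_sequences_def by auto
qed

text \<open>Closure under admissible subobjects and quotients makes the outer terms automatic, so
  only the middle object of a sequence has to be checked.\<close>

lemma admissible_monic_restrict: "admissible_monic E' m \<longleftrightarrow> admissible_monic E m \<and> Cod C m \<in> S"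
  using S_admissible unfolding admissible_monic_def restrict_sequences_def by blast

lemma admissible_monic_Dom: "admissible_monic E m \<Longrightarrow> Cod C m \<in> S \<Longrightarrow> Dom C m \<in> S"
  using S_admissible unfolding admissible_monic_def by blast

lemma pushout_closed:
  assumes m: "admissible_monic E m" "Cod C m \<in> S" and f: "Cod C f \<in> S" and P: "is_pushout C m f m' f'"
  shows "Cod C m' \<in> S"
proof -
  have arrs: "m \<in> Arr C" "f \<in> Arr C" "Dom C m = Dom C f" "m' \<in> Arr C" "f' \<in> Arr C"
    "Dom C m' = Cod C f" "Dom C f' = Cod C m" "Cod C m' = Cod C f'"
    using P unfolding is_pushout_def by blast+
  \<comment> \<open>The indexed form is kept at first because \<open>S_biproduct\<close> needs it to
    place \<open>B\<close> in \<open>S\<close>; the binary form is extracted afterwards for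
    computing.\<close>
  have "\<exists>B \<iota> \<pi>. is_biproduct C 2 (\<lambda>k. if k = 0 then Cod C m else Cod C f) B \<iota> \<pi>"
    using arrs Cod_in_Obj by (intro biproducts_exist) simp
  then obtain B \<iota> \<pi> where biprod: "is_biproduct C 2 (\<lambda>k. if k = 0 then Cod C m else Cod C f) B \<iota> \<pi>"
    by blast
  then have "B \<in> S" using m f by (elim S_biproduct) simp
  obtain i j p q where B: "is_binary_biproduct C (Cod C m) (Cod C f) B i j p q"
    using is_biproduct_imp_binary[OF biprod] by auto
  note [simp] = arrs binary_biproduct_arr[OF B]
  obtain g where g: "g \<in> Hom C (Dom C f) (Cod C f)" "Add C f g = Zero C (Dom C f) (Cod C f)"
      "Add C g f = Zero C (Dom C f) (Cod C f)"
    using negative_exists[of f "Dom C f" "Cod C f"] arrs by (auto simp: Hom_def)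
  note [simp] = HomD[OF g(1)]
  have "admissible_monic E (Add C (i \<cdot> m) (j \<cdot> g))"
    using B m(1) by (rule admissible_monic_pair) (use g in simp)
  then have "(Add C (i \<cdot> m) (j \<cdot> g), Add C (f' \<cdot> p) (m' \<cdot> q)) \<in> E"
    using pushout_cokernel[OF B P g] by (rule E_if_cokernel)
  from S_admissible[OF this] \<open>B \<in> S\<close> show ?thesis by simp
qed

section \<open>The exact structure on the full subcategory\<close>

lemma category_restrict: "category D"
  by unfold_locales
    (use S_subset in \<open>auto simp: Hom_full_subcategory_on intro: Ident_in_Hom Comp_in_Hom Comp_Ident Ident_Comp
      Comp_assoc\<close>)

lemma additive_restrict: "additive_category D"
proof -
  show ?thesis
  proof (intro additive_category.intro preadditive_category.intro category_restrict
      preadditive_category_axioms.intro additive_category_axioms.intro)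
    fix n and X :: "nat \<Rightarrow> 'a"
    assume X: "\<And>k. k < n \<Longrightarrow> X k \<in> Obj D"
    then have "\<exists>B \<iota> \<pi>. is_biproduct C n X B \<iota> \<pi>" using S_subset by (intro biproducts_exist) auto
    then obtain B \<iota> \<pi> where B: "is_biproduct C n X B \<iota> \<pi>" by blast
    then have "B \<in> S" using S_biproduct[OF B] X by simp
    then have "is_biproduct D n X B \<iota> \<pi>" using B X by (intro is_biproduct_full_subcategory_on) auto
    then show "\<exists>B \<iota> \<pi>. is_biproduct D n X B \<iota> \<pi>" by blast
  next
    fix X Y assume "X \<in> Obj D" "Y \<in> Obj D"
    then show "comm_group (Hom_group D X Y)"
      using S_subset Hom_comm_group[of X Y] by (auto simp: Hom_group_full_subcategory_on)
  next
    fix f X Y g Z g' assume "f \<in> Hom D X Y" "g \<in> Hom D Y Z" "g' \<in> Hom D Y Z"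
    then show "Add D g g' \<cdot>\<^bsub>D\<^esub> f = Add D (g \<cdot>\<^bsub>D\<^esub> f) (g' \<cdot>\<^bsub>D\<^esub> f)"
      using Comp_Add_left[of f X Y g Z g'] by (simp add: Hom_full_subcategory_on)
  next
    fix f X Y f' g Z assume "f \<in> Hom D X Y" "f' \<in> Hom D X Y" "g \<in> Hom D Y Z"
    then show "g \<cdot>\<^bsub>D\<^esub> Add D f f' = Add D (g \<cdot>\<^bsub>D\<^esub> f) (g \<cdot>\<^bsub>D\<^esub> f')"
      using Comp_Add_right[of f X Y f' g Z] by (simp add: Hom_full_subcategory_on)
  qed
qed

lemma Ident_admissible_monic_restrict: "X \<in> S \<Longrightarrow> admissible_monic E' (Ident C X)"
  using S_subset Ident_admissible_monic by (auto simp: admissible_monic_restrict)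

lemma admissible_monic_Comp_restrict:
  assumes "admissible_monic E' i" "admissible_monic E' j" "Cod C i = Dom C j"
  shows "admissible_monic E' (j \<cdot> i)"
  using assms admissible_monic_Comp[of i j] admissible_monic_arr
  by (simp add: admissible_monic_restrict)

lemma pushout_exists_restrict:
  assumes m: "admissible_monic E' m" and f: "f \<in> Arr D" "Dom C f = Dom C m"
  shows "\<exists>m' f'. is_pushout D m f m' f' \<and> admissible_monic E' m'"
proof -
  have m: "admissible_monic E m" "Cod C m \<in> S" using m by (auto simp: admissible_monic_restrict)
  obtain m' f' where P: "is_pushout C m f m' f'" using pushout_exists[OF m(1), of f] f by auto
  have "Cod C m' \<in> S" using pushout_closed[OF m _ P] f by simp
  moreover from this have "is_pushout D m f m' f'"
    using P S_subset m f admissible_monic_Dom[OF m] by (auto intro: is_pushout_full_subcategory_on)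
  ultimately show ?thesis
    using pushout_admissible_monic[OF m(1) P] by (auto simp: admissible_monic_restrict)
qed

text \<open>The universal property of \<open>P\<close> is only known against objects of
  \<open>S\<close>, so the ambient axiom does not apply to it directly. The pushout inherited from
  \<open>C\<close> is another pushout in \<open>D\<close>, and the isomorphism between the two
  transports admissibility to \<open>m'\<close>.\<close>

lemma pushout_admissible_monic_restrict:
  assumes m: "admissible_monic E' m" and P: "is_pushout D m f m' f'"
  shows "admissible_monic E' m'"
proof -
  interpret D: category D by (rule category_restrict)
  have f: "f \<in> Arr D" "Dom C f = Dom C m" "m' \<in> Arr D" using P unfolding is_pushout_def by auto
  obtain m0 f0 where Q: "is_pushout D m f m0 f0" and m0: "admissible_monic E' m0"
    using pushout_exists_restrict[OF m f(1,2)] by blast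
  obtain u where u: "is_iso D u (Cod D m0) (Cod D m')" "u \<cdot>\<^bsub>D\<^esub> m0 = m'"
    using D.pushout_iso[OF Q P] by blast
  have "is_iso C u (Cod C m0) (Cod C m')"
    using u(1) unfolding is_iso_def by (auto simp: Hom_full_subcategory_on)
  then have "admissible_monic E (u \<cdot> m0)"
    using m0 by (intro admissible_monic_iso_Comp) (auto simp: admissible_monic_restrict)
  then show ?thesis using u(2) f by (auto simp: admissible_monic_restrict)
qed

lemma kernel_cokernel_pair_restrict:
  assumes "(i, p) \<in> E'"
  shows "kernel_cokernel_pair D i p"
proof -
  have E: "(i, p) \<in> E" and S: "Dom C i \<in> S" "Cod C i \<in> S" "Cod C p \<in> S"
    using assms unfolding restrict_sequences_def by auto
  have k: "is_kernel C i p" and c: "is_cokernel C p i"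
    using E_is_kernel_cokernel[OF E] by auto
  have arrs: "i \<in> Arr C" "p \<in> Arr C" "Cod C i = Dom C p" "p \<cdot> i = Zero C (Dom C i) (Cod C p)"
    using k unfolding is_kernel_def by auto
  have "\<exists>!u. u \<in> Hom C X (Dom C i) \<and> i \<cdot> u = f"
    if "X \<in> S" "f \<in> Hom C X (Dom C p)" "p \<cdot> f = Zero C X (Cod C p)" for X f
    using k that S_subset unfolding is_kernel_def by blast
  moreover have "\<exists>!u. u \<in> Hom C (Cod C p) X \<and> u \<cdot> p = f"
    if "X \<in> S" "f \<in> Hom C (Cod C i) X" "f \<cdot> i = Zero C (Dom C i) X" for X f
    using c that S_subset unfolding is_cokernel_def by blast
  ultimately show ?thesis
    unfolding kernel_cokernel_pair_def is_kernel_def is_cokernel_def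
    using S arrs by (simp add: Hom_full_subcategory_on)
qed

theorem exact_restrict: "exact_category D E'"
proof -
  interpret D: additive_category D by (rule additive_restrict)
  interpret op: admissibly_closed "op_cat C" "E\<inverse>" S by (rule op_cat_admissibly_closed)
  \<comment> \<open>The dual results concern the restriction of the opposite category, the goals
    below the opposite of the restriction; these equations identify the two.\<close>
  have op_D: "op.D = op_cat D" by (rule op_cat_full_subcategory_on)
  have op_E': "op.E' = E'\<inverse>" by (rule restrict_sequences_op_cat)
  show ?thesis
  proof unfold_locales
    fix i p assume "(i, p) \<in> E'"
    then show "kernel_cokernel_pair D i p" by (rule kernel_cokernel_pair_restrict)
  next
    fix i p i' M' N' p' L' a b c
    assume ip: "(i, p) \<in> E'" and i': "i' \<in> Hom D M' N'" and p': "p' \<in> Hom D N' L'"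
      and iso: "is_iso D a (Dom D i) M'" "is_iso D b (Cod D i) N'" "is_iso D c (Cod D p) L'"
      and comm: "b \<cdot>\<^bsub>D\<^esub> i = i' \<cdot>\<^bsub>D\<^esub> a" "c \<cdot>\<^bsub>D\<^esub> p = p' \<cdot>\<^bsub>D\<^esub> b"
    have "is_iso C f X Y" if "is_iso D f X Y" for f X Y
      using that unfolding is_iso_def by (auto simp: Hom_full_subcategory_on)
    then have "(i', p') \<in> E"
      using ip i' p' iso comm
      by (intro E_iso_closed[of i p i' M' N' p' L' a b c])
        (auto simp: restrict_sequences_def Hom_full_subcategory_on)
    then show "(i', p') \<in> E'" using i' p' by (auto simp: restrict_sequences_def Hom_def)
  next
    fix X assume "X \<in> Obj D"
    then show "admissible_monic E' (Ident D X)" "admissible_epic E' (Ident D X)"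
      using Ident_admissible_monic_restrict[of X] op.Ident_admissible_monic_restrict[of X]
      by (simp_all add: op_E')
  next
    fix i j assume "admissible_monic E' i" "admissible_monic E' j" "Cod D i = Dom D j"
    then show "admissible_monic E' (j \<cdot>\<^bsub>D\<^esub> i)" using admissible_monic_Comp_restrict by simp
  next
    fix p q assume "admissible_epic E' p" "admissible_epic E' q" "Cod D p = Dom D q"
    \<comment> \<open>Composition is reversed in the opposite category, hence the instantiation in
      the order \<open>q\<close>, \<open>p\<close>.\<close>
    then show "admissible_epic E' (q \<cdot>\<^bsub>D\<^esub> p)"
      using op.admissible_monic_Comp_restrict[of q p] by (simp add: op_E')
  next
    fix i f assume "admissible_monic E' i" "f \<in> Arr D" "Dom D f = Dom D i"
    then show "\<exists>i' f'. is_pushout D i f i' f'" using pushout_exists_restrict[of i f] by auto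
  next
    fix i f i' f' assume "admissible_monic E' i" "is_pushout D i f i' f'"
    then show "admissible_monic E' i'" by (rule pushout_admissible_monic_restrict)
  next
    fix p f assume "admissible_epic E' p" "f \<in> Arr D" "Cod D f = Cod D p"
    then show "\<exists>p' f'. is_pullback D p f p' f'"
      using op.pushout_exists_restrict[of p f] unfolding op_E' op_D by auto
  next
    fix p f p' f' assume "admissible_epic E' p" "is_pullback D p f p' f'"
    then show "admissible_epic E' p'"
      using op.pushout_admissible_monic_restrict[of p f p' f'] unfolding op_E' op_D by simp
  qed
qed

end

section \<open>The zero locus of \<phi>\<close>

theorem proposition4p1:
  fixes A :: "('o, 'm) cat"
    and E :: "('m \<times> 'm) set"
    and \<phi> :: "'o \<Rightarrow> int"
  assumes exact: "exact_category A E"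
    and nonpos: "\<And>M. M \<in> Obj A \<Longrightarrow> \<phi> M \<le> 0"
    and iso_invariant: "\<And>M N. isomorphic A M N \<Longrightarrow> \<phi> M = \<phi> N"
    and additive: "\<And>n X B \<iota> \<pi>. is_biproduct A n X B \<iota> \<pi> \<Longrightarrow> \<phi> B = (\<Sum>k<n. \<phi> (X k))"
    and subadditive: "\<And>i p. (i, p) \<in> E \<Longrightarrow> \<phi> (Cod A i) \<le> \<phi> (Dom A i) + \<phi> (Cod A p)"
  shows "exact_subcategory
           (full_subcategory_on A {M \<in> Obj A. \<phi> M = 0})
           (restrict_sequences A E {M \<in> Obj A. \<phi> M = 0})
           A E"
proof -
  interpret exact_category A E by (rule exact)
  let ?S = "{M \<in> Obj A. \<phi> M = 0}"
  interpret admissibly_closed A E ?S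
  proof unfold_locales
    fix n X B \<iota> \<pi> assume B: "is_biproduct A n X B \<iota> \<pi>" and X: "\<And>k. k < n \<Longrightarrow> X k \<in> ?S"
    then show "B \<in> ?S" using additive[OF B] unfolding is_biproduct_def by simp
  next
    fix i p assume ip: "(i, p) \<in> E" and N: "Cod A i \<in> ?S"
    have "i \<in> Arr A" "p \<in> Arr A"
      using E_is_kernel_cokernel(1)[OF ip] unfolding is_kernel_def by auto
    then have obj: "Dom A i \<in> Obj A" "Cod A p \<in> Obj A" using Dom_in_Obj Cod_in_Obj by auto
    then show "Dom A i \<in> ?S \<and> Cod A p \<in> ?S"
      using subadditive[OF ip] nonpos[OF obj(1)] nonpos[OF obj(2)] N by auto
  qed auto
  \<comment> \<open>Isomorphism invariance of \<phi> supplies the strictness of the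
    subcategory.\<close>
  have closed: "Y \<in> ?S" if "X \<in> ?S" "isomorphic A X Y" for X Y
    using that iso_invariant[OF that(2)] unfolding isomorphic_def by simp
  have "strictly_full_subcategory D A"
    unfolding strictly_full_subcategory_def
  proof (intro conjI)
    show "\<forall>X Y. X \<in> Obj D \<and> isomorphic A X Y \<longrightarrow> Y \<in> Obj D"
      using closed unfolding full_subcategory_on_simps by blast
  qed auto
  moreover have "E' \<subseteq> E" by (auto simp: restrict_sequences_def)
  ultimately show ?thesis
    using exact exact_restrict unfolding exact_subcategory_def by blast
qed

end
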